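(* Let $\tilde\delta$ be a random vector in $\mathbb{R}^n$ with mean $\mathbf{0}$ and covariance matrix $\Sigma\in\mathbb{R}^{n\times n}$ with $\Sigma_{ii}=1$ for all $i\in[n]$. Let $E$ be the edge set of an undirected graph on $[n]$, let $\mathcal{Z}\subseteq\mathbb{R}^{n_x}_+\times\mathbb{R}^{n_y}_+$, and let $C\in\mathbb{R}^{n\times n_x}$, $d\in\mathbb{R}^{n_y}$, $c\in\mathbb{R}$. Given $p\in(0,1)$, let $\gamma_{ij}\ge\sqrt{1/p-1}\,\|\Sigma^{1/2}e_{ij}\|$ for all $i,j\in[n]$ such that $\{i,j\}\in E$ or $i=j$, and let $$\mathcal{U}_{\mathcal S}=\{\delta\in\mathbb{R}^n : |\delta_i|\le\gamma_{ii}\ \forall i\in[n],\ |\delta_i-\delta_j|\le\gamma_{ij}\ \forall \{i,j\}\in E\}.$$ Then for every $(x,y)\in\mathcal{Z}$ satisfying $\max_{\delta\in\mathcal{U}_{\mathcal S}}\delta^\top Cx+d^\top y\le c$, one has $\mathbb{P}[\tilde\delta^\top Cx+d^\top y>c]\le p$.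
   Context: $[n]=\{1,\dots,n\}$; $\|\cdot\|$ is the Euclidean norm; $\Sigma^{1/2}$ is the symmetric positive semidefinite square root of $\Sigma$. With $e_i$ the standard unit vectors of $\mathbb{R}^n$, $e_{ij}=e_i-e_j$ if $i\ne j$ and $e_{ii}=e_i$. Edges of the graph join distinct vertices, and $\gamma_{ij}=\gamma_{ji}$. *)

theory Defs
  imports "HOL-Probability.Probability"
begin

definition mean_vector :: "'a measure \<Rightarrow> ('a \<Rightarrow> real^'n) \<Rightarrow> real^'n" where
  "mean_vector M X = (\<integral>\<omega>. X \<omega> \<partial>M)"

definition covariance_matrix :: "'a measure \<Rightarrow> ('a \<Rightarrow> real^'n) \<Rightarrow> real^'n^'n" where
  "covariance_matrix M X =
     (\<chi> i j. \<integral>\<omega>. (X \<omega> $ i - mean_vector M X $ i) * (X \<omega> $ j - mean_vector M X $ j) \<partial>M)"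

definition sym_psd :: "real^'n^'n \<Rightarrow> bool" where
  "sym_psd A \<longleftrightarrow> transpose A = A \<and> (\<forall>v. v \<bullet> (A *v v) \<ge> 0)"

(* Meaningful for symmetric positive semidefinite A, where exactly one such B exists. *)
definition psd_sqrt :: "real^'n^'n \<Rightarrow> real^'n^'n" where
  "psd_sqrt A = (THE B. sym_psd B \<and> B ** B = A)"

definition edge_vec :: "'n \<Rightarrow> 'n \<Rightarrow> real^'n" where
  "edge_vec i j = (if i = j then axis i 1 else axis i 1 - axis j 1)"

definition uncertainty_set :: "'n set set \<Rightarrow> ('n \<Rightarrow> 'n \<Rightarrow> real) \<Rightarrow> (real^'n) set" where
  "uncertainty_set E \<gamma> =
     {\<delta>. (\<forall>i. \<bar>\<delta> $ i\<bar> \<le> \<gamma> i i) \<and>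
          (\<forall>i j. {i, j} \<in> E \<longrightarrow> \<bar>\<delta> $ i - \<delta> $ j\<bar> \<le> \<gamma> i j)}"

(* The largest value of f on S, an element of f ` S; unspecified if it is not attained.
   (Max is restricted to finite sets.) *)
definition max_on :: "'a set \<Rightarrow> ('a \<Rightarrow> real) \<Rightarrow> real" where
  "max_on S f = (GREATEST m. m \<in> f ` S)"

end

theory Submission
  imports Defs
begin

text \<open>
  Put \<open>a = C *v x\<close>, \<open>S = psd_sqrt \<Sigma>\<close> and \<open>r = sqrt (1 / p - 1)\<close>. The uncertainty set contains
  the ellipsoid that consists of all \<open>r *\<^sub>R (S *v w)\<close> with \<open>norm w \<le> 1\<close>: by Cauchy-Schwarz, a
  linear form \<open>e\<close> is at most \<open>r * norm (S *v e)\<close> on this ellipsoid, and for \<open>e = edge_vec i j\<close>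
  this is at most \<open>\<gamma> i j\<close>. For the form \<open>a\<close> the bound is attained, so robust feasibility gives
  \<open>r * norm (S *v a) + d \<bullet> y \<le> c\<close>.

  The random variable \<open>Y = \<delta>' \<bullet> a\<close> has mean zero and variance
  \<open>a \<bullet> (\<Sigma> *v a) = (norm (S *v a))\<^sup>2\<close>. Hence violating the constraint means that \<open>Y\<close> exceeds
  some \<open>t\<close> that is at least \<open>r\<close> standard deviations, and the one-sided Chebyshev inequality of
  Cantelli bounds the probability of this by \<open>1 / (1 + r\<^sup>2) = p\<close>.

  Two facts underlie this argument. The square root, which is given by a definite description, has
  to exist and be unique (\<open>psd_sqrt\<close>); existence comes from splitting off eigenvectors one at a
  time, uniqueness from a trace identity. The maximum, likewise given by a description, has to be
  attained (\<open>max_on_upper\<close>), which holds because the uncertainty set is compact.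
\<close>

section \<open>Symmetric positive semidefinite matrices\<close>

lemma sym_psd_iff:
  "sym_psd A \<longleftrightarrow> (\<forall>x y. (A *v x) \<bullet> y = x \<bullet> (A *v y)) \<and> (\<forall>v. v \<bullet> (A *v v) \<ge> 0)"
proof -
  have "transpose A = A \<longleftrightarrow> (\<forall>x. transpose A *v x = A *v x)"
    by (rule matrix_eq)
  also have "\<dots> \<longleftrightarrow> (\<forall>x y. (transpose A *v x) \<bullet> y = (A *v x) \<bullet> y)"
    using vector_eq_rdot by (metis inner_commute)
  also have "\<dots> \<longleftrightarrow> (\<forall>x y. (A *v x) \<bullet> y = x \<bullet> (A *v y))"
    by (simp add: dot_lmul_matrix eq_commute)
  finally show ?thesis
    by (auto simp: sym_psd_def)
qed

lemma sym_psd_inner: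
  assumes "sym_psd A" shows "(A *v x) \<bullet> y = x \<bullet> (A *v y)"
  using assms by (simp add: sym_psd_iff)

lemma sym_psd_nonneg:
  assumes "sym_psd A" shows "v \<bullet> (A *v v) \<ge> 0"
  using assms by (simp add: sym_psd_iff)

text \<open>
  The nonnegative quadratic form \<open>v \<bullet> (A *v v)\<close> has a minimum at \<open>w\<close>, so its derivative there, which
  is \<open>2 *\<^sub>R (A *v w)\<close>, must vanish. The proof makes this explicit by a small step from \<open>w\<close> in the
  direction opposite to \<open>A *v w\<close>.
\<close>

lemma sym_psd_kernel:
  fixes A :: "real^'n^'n"
  assumes A: "sym_psd A" and zero: "w \<bullet> (A *v w) = 0"
  shows "A *v w = 0"
proof (rule ccontr)
  assume "A *v w \<noteq> 0"
  define z where "z = A *v w"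
  define a where "a = z \<bullet> z"
  define b where "b = z \<bullet> (A *v z)"
  \<comment> \<open>The form at \<open>w + t *\<^sub>R z\<close> is \<open>2 * t * a + t\<^sup>2 * b\<close>; its minimiser is \<open>- a / b\<close>, and \<open>b + 1\<close>
     instead of \<open>b\<close> covers the case \<open>b = 0\<close>.\<close>
  define t where "t = - a / (b + 1)"
  have a: "a > 0"
    using \<open>A *v w \<noteq> 0\<close> by (simp add: a_def z_def)
  have b: "b \<ge> 0"
    using A by (simp add: b_def sym_psd_nonneg)
  have "w \<bullet> (A *v z) = a"
    using sym_psd_inner[OF A, of w z] by (simp add: a_def z_def)
  then have "(w + t *\<^sub>R z) \<bullet> (A *v (w + t *\<^sub>R z)) = 2 * t * a + t\<^sup>2 * b"
    using zero by (simp add: matrix_vector_right_distrib matrix_vector_mult_scaleR inner_add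
        z_def[symmetric] a_def[symmetric] b_def[symmetric] power2_eq_square algebra_simps)
  also have "\<dots> = - (a\<^sup>2 * (b + 2)) / (b + 1)\<^sup>2"
  proof -
    have "t * (b + 1) = - a" using b by (simp add: t_def)
    then have "(2 * t * a + t\<^sup>2 * b) * (b + 1)\<^sup>2 = - (a\<^sup>2 * (b + 2))"
      by algebra
    moreover have "(b + 1)\<^sup>2 \<noteq> 0" using b by simp
    ultimately show ?thesis
      using nonzero_eq_divide_eq by blast
  qed
  also have "\<dots> < 0"
    using a b by (simp add: divide_neg_pos)
  finally show False
    using sym_psd_nonneg[OF A] by (metis not_le)
qed

text \<open>
  A maximiser \<open>v\<close> of the form on the unit sphere is an eigenvector: with \<open>l\<close> the maximum, the
  matrix \<open>l *\<^sub>R mat 1 - A\<close> is positive semidefinite and its form vanishes at \<open>v\<close>, so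
  \<open>sym_psd_kernel\<close> applies to it. The last conclusion says that \<open>l = 0\<close> only if \<open>A = 0\<close>.
\<close>

lemma sym_psd_top_eigenvector:
  fixes A :: "real^'n^'n"
  assumes A: "sym_psd A"
  obtains v l where "norm v = 1" "l \<ge> 0" "A *v v = l *\<^sub>R v" "\<And>x. x \<bullet> (A *v x) \<le> l * (x \<bullet> x)"
proof -
  let ?S = "sphere 0 1 :: (real^'n) set"
  have "continuous_on ?S (\<lambda>x. x \<bullet> (A *v x))"
    by (intro continuous_intros matrix_vector_mult_linear_continuous_on)
  then obtain v where v: "v \<in> ?S" and max: "\<And>x. x \<in> ?S \<Longrightarrow> x \<bullet> (A *v x) \<le> v \<bullet> (A *v v)"
    using continuous_attains_sup[of ?S "\<lambda>x. x \<bullet> (A *v x)"] by auto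
  define l where "l = v \<bullet> (A *v v)"
  have le: "x \<bullet> (A *v x) \<le> l * (x \<bullet> x)" for x
  proof (cases "x = 0")
    case False
    let ?u = "x /\<^sub>R norm x"
    have "?u \<bullet> (A *v ?u) \<le> l"
      using False by (intro max[of ?u, folded l_def]) simp
    then have "x \<bullet> (A *v x) / (norm x)\<^sup>2 \<le> l"
      by (simp add: matrix_vector_mult_scaleR field_simps power2_eq_square)
    then show ?thesis
      using False by (simp add: field_simps power2_norm_eq_inner)
  qed simp
  let ?B = "l *\<^sub>R mat 1 - A"
  have B: "?B *v x = l *\<^sub>R x - A *v x" for x
    by (simp add: matrix_vector_mult_diff_rdistrib scaleR_matrix_vector_assoc[symmetric])
  have "sym_psd ?B"
    using le by (auto simp: sym_psd_iff B inner_diff sym_psd_inner[OF A])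
  moreover have "v \<bullet> (?B *v v) = 0"
    using v by (simp add: B inner_diff l_def[symmetric] norm_eq_1)
  ultimately have "?B *v v = 0"
    by (rule sym_psd_kernel)
  then have "A *v v = l *\<^sub>R v"
    by (simp only: B right_minus_eq)
  moreover have "norm v = 1" "l \<ge> 0"
    using v sym_psd_nonneg[OF A, of v] by (simp_all add: l_def)
  ultimately show thesis
    using le that by blast
qed

section \<open>Existence and uniqueness of the square root\<close>

text \<open>
  Deflation: if \<open>v\<close> is a unit eigenvector for \<open>l > 0\<close>, then \<open>A' = A - l v v\<^sup>T\<close> is again positive
  semidefinite and has a larger kernel, which now contains \<open>v\<close>. A square root \<open>B'\<close> of \<open>A'\<close>
  annihilates \<open>v\<close>, so no cross terms appear in the square of \<open>B' + sqrt l v v\<^sup>T\<close>, which is \<open>A\<close>.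
\<close>

lemma ex_sym_psd_square_root:
  fixes A :: "real^'n^'n"
  assumes "sym_psd A"
  shows "\<exists>B. sym_psd B \<and> B ** B = A"
  using assms
proof (induction "CARD('n) - dim {x. A *v x = 0}" arbitrary: A rule: less_induct)
  case less
  obtain v l where v: "norm v = 1" and l: "l \<ge> 0" and ev: "A *v v = l *\<^sub>R v"
    and top: "\<And>x. x \<bullet> (A *v x) \<le> l * (x \<bullet> x)"
    using sym_psd_top_eigenvector[OF less.prems] by blast
  have vv: "v \<bullet> v = 1"
    using v by (simp add: norm_eq_1)
  show ?case
  proof (cases "l = 0")
    case True
    have "A *v x = 0" for x
      using top[of x] sym_psd_nonneg[OF less.prems, of x] True
      by (intro sym_psd_kernel[OF less.prems]) simp
    then have "A = 0"
      by (simp add: matrix_eq)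
    then have "sym_psd A \<and> A ** A = A"
      using less.prems by (simp add: matrix_eq matrix_vector_mul_assoc[symmetric])
    then show ?thesis by blast
  next
    case False
    have vA: "v \<bullet> (A *v x) = l * (v \<bullet> x)" for x
      using sym_psd_inner[OF less.prems, of v x] ev by simp
    define A' where "A' = matrix (\<lambda>x. A *v x - (l * (v \<bullet> x)) *\<^sub>R v)"
    have A': "A' *v x = A *v x - (l * (v \<bullet> x)) *\<^sub>R v" for x
      unfolding A'_def
      by (rule matrix_works, unfold linear_matrix_vector_mul_eq)
        (auto intro!: linearI simp: matrix_vector_right_distrib matrix_vector_mult_scaleR algebra_simps)
    have "sym_psd A'"
    proof -
      have "0 \<le> x \<bullet> (A' *v x)" for x
      proof -
        \<comment> \<open>The form of \<open>A'\<close> is that of \<open>A\<close> at the component orthogonal to \<open>v\<close>.\<close>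
        let ?y = "x - (v \<bullet> x) *\<^sub>R v"
        have "x \<bullet> (A' *v x) = ?y \<bullet> (A *v ?y)"
          by (simp add: A' matrix_vector_mult_diff_distrib matrix_vector_mult_scaleR inner_diff vA ev vv
              inner_commute algebra_simps)
        then show ?thesis
          using sym_psd_nonneg[OF less.prems, of ?y] by simp
      qed
      then show ?thesis
        by (auto simp: sym_psd_iff A' inner_diff sym_psd_inner[OF less.prems] inner_commute[of _ v])
    qed
    moreover have "dim {x. A *v x = 0} < dim {x. A' *v x = 0}"
    proof (rule dim_psubset)
      have sub: "subspace {x. L *v x = 0}" for L :: "real^'n^'n"
        by (auto simp: subspace_def matrix_vector_right_distrib matrix_vector_mult_scaleR)
      have "{x. A *v x = 0} \<subseteq> {x. A' *v x = 0}"
        using vA False by (auto simp: A') (metis inner_zero_right mult_eq_0_iff)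
      moreover have "v \<in> {x. A' *v x = 0}" "v \<notin> {x. A *v x = 0}"
        using False v by (auto simp: A' ev vv)
      ultimately show "span {x. A *v x = 0} \<subset> span {x. A' *v x = 0}"
        unfolding span_eq_iff[THEN iffD2, OF sub] by blast
    qed
    moreover have "dim {x. A' *v x = 0} \<le> CARD('n)"
      using dim_subset_UNIV[of "{x. A' *v x = 0}"] by simp
    ultimately obtain B' where B': "sym_psd B'" "B' ** B' = A'"
      using less.hyps[of A'] by force
    have B'B': "B' *v (B' *v x) = A' *v x" for x
      using B'(2) by (simp add: matrix_vector_mul_assoc)
    have "(B' *v v) \<bullet> (B' *v v) = 0"
      using sym_psd_inner[OF B'(1)] by (simp add: B'B' A' ev vv)
    then have B'v: "B' *v v = 0" by simp
    have vB': "v \<bullet> (B' *v x) = 0" for x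
      using sym_psd_inner[OF B'(1), of v x] B'v by simp
    define B where "B = matrix (\<lambda>x. B' *v x + (sqrt l * (v \<bullet> x)) *\<^sub>R v)"
    have B: "B *v x = B' *v x + (sqrt l * (v \<bullet> x)) *\<^sub>R v" for x
      unfolding B_def
      by (rule matrix_works, unfold linear_matrix_vector_mul_eq)
        (auto intro!: linearI simp: matrix_vector_right_distrib matrix_vector_mult_scaleR algebra_simps)
    have "sym_psd B"
      using l by (auto simp: sym_psd_iff B inner_add sym_psd_inner[OF B'(1)] sym_psd_nonneg[OF B'(1)]
          inner_commute[of _ v] mult.assoc)
    moreover have "B ** B = A"
      using l by (simp add: matrix_eq matrix_vector_mul_assoc[symmetric] B matrix_vector_right_distrib
          matrix_vector_mult_scaleR inner_add B'B' B'v vB' vv A')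
    ultimately show ?thesis by blast
  qed
qed

text \<open>
  With \<open>D = X - Y\<close>, equality of the squares gives \<open>X D + D Y = 0\<close>, although \<open>X\<close> and \<open>Y\<close> need not
  commute. Multiplying by \<open>D\<close> on the left and taking traces, which are cyclic, gives
  \<open>trace (D X D) + trace (D Y D) = 0\<close>. Both matrices are positive semidefinite, so every diagonal entry vanishes; then \<open>X D = Y D = 0\<close> by
  \<open>sym_psd_kernel\<close>, whence \<open>D\<^sup>2 = 0\<close> and, by symmetry of \<open>D\<close>, \<open>D = 0\<close>.
\<close>

lemma sym_psd_square_root_unique:
  fixes X Y :: "real^'n^'n"
  assumes X: "sym_psd X" and Y: "sym_psd Y" and eq: "X ** X = Y ** Y"
  shows "X = Y"
proof -
  define D where "D = X - Y"
  have D: "D *v x = X *v x - Y *v x" for x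
    by (simp add: D_def matrix_vector_mult_diff_rdistrib)
  have D_inner: "(D *v x) \<bullet> y = x \<bullet> (D *v y)" for x y
    by (simp add: D inner_diff sym_psd_inner[OF X] sym_psd_inner[OF Y])
  have XXYY: "X *v (X *v x) = Y *v (Y *v x)" for x
    using eq by (simp add: matrix_vector_mul_assoc)
  have tr: "trace (D ** (P ** D)) = (\<Sum>i\<in>UNIV. (D *v axis i 1) \<bullet> (P *v (D *v axis i 1)))" for P
  proof -
    have "Q $ i $ i = axis i 1 \<bullet> (Q *v axis i 1)" for Q :: "real^'n^'n" and i
      by (simp add: inner_axis' matrix_vector_mult_basis column_def)
    then show ?thesis
      by (simp add: trace_def D_inner matrix_vector_mul_assoc[symmetric])
  qed
  have "trace (D ** (X ** D)) + trace (D ** (Y ** D)) = 0"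
  proof -
    have "trace (D ** (Y ** D)) = trace (D ** (D ** Y))"
      by (metis matrix_mul_assoc trace_mul_sym)
    moreover have "D ** (X ** D) + D ** (D ** Y) = 0"
      by (simp add: matrix_eq matrix_vector_mult_add_rdistrib matrix_vector_mul_assoc[symmetric] D
          matrix_vector_mult_diff_distrib XXYY)
    moreover have "trace (0 :: real^'n^'n) = 0"
      by (simp add: trace_def)
    ultimately show ?thesis
      by (metis trace_add)
  qed
  then have sum: "(\<Sum>i\<in>UNIV. (D *v axis i 1) \<bullet> (X *v (D *v axis i 1)) +
      (D *v axis i 1) \<bullet> (Y *v (D *v axis i 1))) = 0"
    by (simp add: tr sum.distrib)
  have "D *v axis i 1 = 0" for i
  proof -
    let ?u = "D *v axis i 1"
    have "?u \<bullet> (X *v ?u) + ?u \<bullet> (Y *v ?u) = 0"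
      using sum by (subst (asm) sum_nonneg_eq_0_iff) (auto simp: sym_psd_nonneg X Y)
    then have "?u \<bullet> (X *v ?u) = 0" "?u \<bullet> (Y *v ?u) = 0"
      using sym_psd_nonneg[OF X, of ?u] sym_psd_nonneg[OF Y, of ?u] by linarith+
    then have "X *v ?u = 0" "Y *v ?u = 0"
      using sym_psd_kernel X Y by blast+
    then have "D *v ?u = 0"
      by (simp only: D[of ?u] diff_self)
    then have "?u \<bullet> ?u = 0"
      by (simp add: D_inner)
    then show ?thesis by simp
  qed
  then have "D = 0"
    by (simp add: matrix_vector_mult_basis column_def vec_eq_iff)
  then show ?thesis by (simp add: D_def)
qed

lemma psd_sqrt:
  fixes A :: "real^'n^'n"
  assumes "sym_psd A"
  shows sym_psd_psd_sqrt: "sym_psd (psd_sqrt A)" and psd_sqrt_square: "psd_sqrt A ** psd_sqrt A = A"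
proof -
  have "\<exists>!B. sym_psd B \<and> B ** B = A"
    using ex_sym_psd_square_root[OF assms] by (auto intro: sym_psd_square_root_unique)
  then have "sym_psd (psd_sqrt A) \<and> psd_sqrt A ** psd_sqrt A = A"
    unfolding psd_sqrt_def by (rule theI')
  then show "sym_psd (psd_sqrt A)" "psd_sqrt A ** psd_sqrt A = A" by simp_all
qed

lemma norm_psd_sqrt_mult:
  assumes "sym_psd A"
  shows "(norm (psd_sqrt A *v a))\<^sup>2 = a \<bullet> (A *v a)"
proof -
  have "psd_sqrt A *v (psd_sqrt A *v a) = A *v a"
    by (simp add: matrix_vector_mul_assoc psd_sqrt_square[OF assms])
  then show ?thesis
    by (simp add: power2_norm_eq_inner sym_psd_inner[OF sym_psd_psd_sqrt[OF assms]])
qed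

section \<open>The ellipsoid inside the uncertainty set\<close>

text \<open>
  The point \<open>u\<close> maximises the form \<open>a\<close> on the ellipsoid \<open>{r *\<^sub>R (S *v w) | norm w \<le> 1}\<close>, where
  \<open>S = psd_sqrt A\<close>: equality in Cauchy-Schwarz is reached when \<open>w\<close> is the unit vector along
  \<open>S *v a\<close>. The second conclusion is how membership in the ellipsoid is used: it bounds every other
  form \<open>e\<close> by the maximum of \<open>e\<close>.
\<close>

lemma ellipsoid_extremal_point:
  assumes "sym_psd A" "r \<ge> 0"
  obtains u where "u \<bullet> a = r * norm (psd_sqrt A *v a)"
    "\<And>e. \<bar>u \<bullet> e\<bar> \<le> r * norm (psd_sqrt A *v e)"
proof -
  let ?S = "psd_sqrt A"
  \<comment> \<open>If \<open>?S *v a = 0\<close>, division by zero makes \<open>u\<close> the centre of the ellipsoid, as desired.\<close>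
  define u where "u = (r / norm (?S *v a)) *\<^sub>R (?S *v (?S *v a))"
  have u: "u \<bullet> e = r / norm (?S *v a) * ((?S *v a) \<bullet> (?S *v e))" for e
    by (simp add: u_def sym_psd_inner[OF sym_psd_psd_sqrt[OF assms(1)]])
  have "u \<bullet> a = r * norm (?S *v a)"
    by (simp add: u power2_norm_eq_inner[symmetric] power2_eq_square)
  moreover have "\<bar>u \<bullet> e\<bar> \<le> r * norm (?S *v e)" for e
  proof (cases "?S *v a = 0")
    case False
    have "\<bar>u \<bullet> e\<bar> = r / norm (?S *v a) * \<bar>(?S *v a) \<bullet> (?S *v e)\<bar>"
      using assms(2) by (simp add: u abs_mult)
    also have "\<dots> \<le> r / norm (?S *v a) * (norm (?S *v a) * norm (?S *v e))"
      using assms(2) by (intro mult_left_mono Cauchy_Schwarz_ineq2) simp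
    finally show ?thesis
      using False by simp
  qed (use assms(2) in \<open>simp add: u\<close>)
  ultimately show thesis by (rule that)
qed

lemma compact_uncertainty_set:
  fixes \<gamma> :: "'n::finite \<Rightarrow> 'n \<Rightarrow> real"
  shows "compact (uncertainty_set E \<gamma>)"
proof -
  have "uncertainty_set E \<gamma> =
    cbox (\<chi> i. - \<gamma> i i) (\<chi> i. \<gamma> i i) \<inter>
    (\<Inter>i. \<Inter>j. {\<delta>. {i, j} \<in> E \<longrightarrow> \<bar>\<delta> $ i - \<delta> $ j\<bar> \<le> \<gamma> i j})"
    by (auto simp: uncertainty_set_def mem_box_cart abs_le_iff)
     (metis minus_le_iff)+
  moreover have "closed {\<delta> :: real^'n. {i, j} \<in> E \<longrightarrow> \<bar>\<delta> $ i - \<delta> $ j\<bar> \<le> \<gamma> i j}" for i j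
    by (intro closed_Collect_imp closed_Collect_le continuous_intros) auto
  ultimately show ?thesis
    by (auto intro!: compact_Int_closed closed_INT)
qed

text \<open>
  Compactness is what makes \<open>max_on\<close> meaningful: without a maximiser, \<open>GREATEST\<close> would be
  unspecified.
\<close>

lemma max_on_upper:
  assumes "compact S" "continuous_on S f" "x \<in> S"
  shows "f x \<le> max_on S f"
proof -
  obtain z where "z \<in> S" "\<forall>y\<in>S. f y \<le> f z"
    using continuous_attains_sup[of S f] assms by blast
  then have "max_on S f = f z"
    unfolding max_on_def by (intro Greatest_equality) auto
  then show ?thesis
    using \<open>\<forall>y\<in>S. f y \<le> f z\<close> assms(3) by simp
qed

section \<open>The one-sided Chebyshev inequality\<close>

text \<open>
  Apply Markov's inequality to \<open>(Y + u)\<^sup>2\<close>. For each \<open>u \<ge> 0\<close> the event \<open>Y \<ge> t\<close> implies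
  \<open>(Y + u)\<^sup>2 \<ge> (t + u)\<^sup>2\<close>, which bounds its probability by \<open>(v + u\<^sup>2) / (t + u)\<^sup>2\<close> with \<open>v\<close> the
  variance; the shift \<open>u = v / t\<close> minimises this bound.
\<close>

lemma (in prob_space) cantelli_inequality:
  fixes Y :: "'a \<Rightarrow> real"
  assumes meas: "Y \<in> borel_measurable M" and int: "integrable M (\<lambda>\<omega>. (Y \<omega>)\<^sup>2)"
    and mean: "expectation Y = 0" and "t > 0"
  shows "prob {\<omega> \<in> space M. Y \<omega> \<ge> t} \<le> expectation (\<lambda>\<omega>. (Y \<omega>)\<^sup>2) / (expectation (\<lambda>\<omega>. (Y \<omega>)\<^sup>2) + t\<^sup>2)"
proof -
  note [measurable] = meas
  define v where "v = expectation (\<lambda>\<omega>. (Y \<omega>)\<^sup>2)"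
  define u where "u = v / t"
  have v: "v \<ge> 0" by (simp add: v_def)
  have u: "u \<ge> 0" using v \<open>t > 0\<close> by (simp add: u_def)
  have intY: "integrable M Y"
    using meas int by (rule square_integrable_imp_integrable)
  have sq: "(Y \<omega> + u)\<^sup>2 = (Y \<omega>)\<^sup>2 + 2 * u * Y \<omega> + u\<^sup>2" for \<omega>
    by (simp add: power2_sum)
  have intU: "integrable M (\<lambda>\<omega>. (Y \<omega> + u)\<^sup>2)"
    using int intY by (simp add: sq)
  have "prob {\<omega> \<in> space M. Y \<omega> \<ge> t} \<le> prob {\<omega> \<in> space M. (Y \<omega> + u)\<^sup>2 \<ge> (t + u)\<^sup>2}"
    using u \<open>t > 0\<close> by (intro finite_measure_mono) (auto intro!: power_mono)
  also have "\<dots> \<le> expectation (\<lambda>\<omega>. (Y \<omega> + u)\<^sup>2) / (t + u)\<^sup>2"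
    using u \<open>t > 0\<close> by (intro integral_Markov_inequality_measure[OF intU sets.empty_sets]) auto
  also have "expectation (\<lambda>\<omega>. (Y \<omega> + u)\<^sup>2) = v + u\<^sup>2"
    using int intY by (simp add: sq v_def mean prob_space)
  also have "(v + u\<^sup>2) / (t + u)\<^sup>2 = v / (v + t\<^sup>2)"
  proof -
    have "v + t\<^sup>2 > 0" using v \<open>t > 0\<close> by (simp add: add_nonneg_pos)
    moreover have "v + u\<^sup>2 = v * (v + t\<^sup>2) / t\<^sup>2" "(t + u)\<^sup>2 = (v + t\<^sup>2)\<^sup>2 / t\<^sup>2"
      using \<open>t > 0\<close> by (simp_all add: u_def field_simps power2_eq_square)
    ultimately show ?thesis
      using \<open>t > 0\<close> by (simp add: power2_eq_square)
  qed
  finally show ?thesis by (simp add: v_def)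
qed

text \<open>
  Cantelli's bound \<open>v / (v + t\<^sup>2)\<close> is at most \<open>p\<close> as soon as \<open>t\<^sup>2 \<ge> (1 / p - 1) * v\<close>. The case
  \<open>v = 0\<close> is separate, since then \<open>t = 0\<close> is possible; there \<open>Y\<close> vanishes almost surely, and the
  strict inequality \<open>Y > t\<close> in the event is essential.
\<close>

lemma (in prob_space) prob_exceeds_sqrt_variance:
  fixes Y :: "'a \<Rightarrow> real"
  assumes meas: "Y \<in> borel_measurable M" and int: "integrable M (\<lambda>\<omega>. (Y \<omega>)\<^sup>2)"
    and mean: "expectation Y = 0" and p: "0 < p" "p < 1"
    and t: "t \<ge> sqrt (1 / p - 1) * sqrt (expectation (\<lambda>\<omega>. (Y \<omega>)\<^sup>2))"
  shows "prob {\<omega> \<in> space M. Y \<omega> > t} \<le> p"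
proof -
  note [measurable] = meas
  define v where "v = expectation (\<lambda>\<omega>. (Y \<omega>)\<^sup>2)"
  have v: "v \<ge> 0" by (simp add: v_def)
  have \<kappa>: "1 / p - 1 > 0" using p by simp
  have "t \<ge> 0"
    by (rule order_trans[OF _ t]) (use v \<kappa> in \<open>simp add: v_def[symmetric]\<close>)
  show ?thesis
  proof (cases "v = 0")
    case True
    then have "AE \<omega> in M. (Y \<omega>)\<^sup>2 = 0"
      using integral_nonneg_eq_0_iff_AE[OF int] by (simp add: v_def)
    then have "AE \<omega> in M. \<not> Y \<omega> > t"
      by eventually_elim (use \<open>t \<ge> 0\<close> in simp)
    then have "prob {\<omega> \<in> space M. Y \<omega> > t} = 0"
      by (intro prob_eq_0[THEN iffD2]) (auto elim: eventually_mono)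
    then show ?thesis using p by simp
  next
    case False
    then have v: "v > 0" using v by simp
    have "0 < sqrt (1 / p - 1) * sqrt v"
      using v \<kappa> by simp
    then have "t > 0" using t by (simp add: v_def)
    have "(sqrt (1 / p - 1) * sqrt v)\<^sup>2 \<le> t\<^sup>2"
      using t v \<kappa> by (intro power_mono) (simp_all add: v_def)
    then have le: "(1 / p - 1) * v \<le> t\<^sup>2"
      using v \<kappa> by (simp add: power_mult_distrib)
    have "prob {\<omega> \<in> space M. Y \<omega> > t} \<le> prob {\<omega> \<in> space M. Y \<omega> \<ge> t}"
      by (intro finite_measure_mono) auto
    also have "\<dots> \<le> v / (v + t\<^sup>2)"
      using cantelli_inequality[OF meas int mean \<open>t > 0\<close>] by (simp add: v_def)
    also have "\<dots> \<le> p"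
    proof -
      have "v \<le> p * (v + t\<^sup>2)"
        using le p by (simp add: field_simps)
      then show ?thesis
        using v by (simp add: divide_le_eq add_pos_nonneg)
    qed
    finally show ?thesis .
  qed
qed

section \<open>Second moments of linear forms\<close>

lemma (in prob_space) centred_linear_form:
  fixes X :: "'a \<Rightarrow> real^'n::finite"
  assumes X[measurable]: "X \<in> borel_measurable M"
    and sq: "\<And>i. integrable M (\<lambda>\<omega>. (X \<omega> $ i)\<^sup>2)"
    and mean: "mean_vector M X = 0"
  shows linear_form_mean: "expectation (\<lambda>\<omega>. X \<omega> \<bullet> a) = 0"
    and linear_form_square_integrable: "integrable M (\<lambda>\<omega>. (X \<omega> \<bullet> a)\<^sup>2)"
    and linear_form_variance: "expectation (\<lambda>\<omega>. (X \<omega> \<bullet> a)\<^sup>2) = a \<bullet> (covariance_matrix M X *v a)"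
proof -
  have meas[measurable]: "(\<lambda>\<omega>. X \<omega> $ i) \<in> borel_measurable M" for i
    using borel_measurable_inner[OF X, of "\<lambda>_. axis i 1"] by (simp add: inner_axis)
  \<comment> \<open>Square integrability of the coordinates dominates the mixed products in the covariance.\<close>
  have prod: "integrable M (\<lambda>\<omega>. X \<omega> $ i * X \<omega> $ j)" for i j
  proof (rule Bochner_Integration.integrable_bound)
    show "integrable M (\<lambda>\<omega>. (X \<omega> $ i)\<^sup>2 + (X \<omega> $ j)\<^sup>2)"
      using sq by simp
    have "\<bar>s * t\<bar> \<le> s\<^sup>2 + t\<^sup>2" for s t :: real
      using sum_squares_bound[of "\<bar>s\<bar>" "\<bar>t\<bar>"] mult_nonneg_nonneg[OF abs_ge_zero[of s] abs_ge_zero[of t]]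
      unfolding abs_mult power2_abs mult.assoc by linarith
    then show "AE \<omega> in M. norm (X \<omega> $ i * X \<omega> $ j) \<le> norm ((X \<omega> $ i)\<^sup>2 + (X \<omega> $ j)\<^sup>2)"
      by simp
  qed measurable
  have int: "integrable M X"
  proof -
    have "integrable M (\<lambda>\<omega>. \<Sum>i\<in>UNIV. (X \<omega> $ i) *\<^sub>R axis i (1::real))"
      using square_integrable_imp_integrable[OF meas sq] by simp
    moreover have "(\<Sum>i\<in>UNIV. (x $ i) *\<^sub>R axis i (1::real)) = x" for x :: "real^'n"
      using basis_expansion[of x] by (simp add: scalar_mult_eq_scaleR)
    ultimately show ?thesis by simp
  qed
  show "expectation (\<lambda>\<omega>. X \<omega> \<bullet> a) = 0"
    using int mean by (simp add: mean_vector_def)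
  have expand: "(X \<omega> \<bullet> a)\<^sup>2 = (\<Sum>i\<in>UNIV. \<Sum>j\<in>UNIV. a $ i * a $ j * (X \<omega> $ i * X \<omega> $ j))" for \<omega>
    by (simp add: inner_vec_def power2_eq_square sum_product algebra_simps)
  show "integrable M (\<lambda>\<omega>. (X \<omega> \<bullet> a)\<^sup>2)"
    unfolding expand using prod by simp
  have "expectation (\<lambda>\<omega>. (X \<omega> \<bullet> a)\<^sup>2) =
      (\<Sum>i\<in>UNIV. \<Sum>j\<in>UNIV. a $ i * a $ j * expectation (\<lambda>\<omega>. X \<omega> $ i * X \<omega> $ j))"
    unfolding expand using prod by simp
  also have "\<dots> = a \<bullet> (covariance_matrix M X *v a)"
    by (simp add: covariance_matrix_def mean inner_vec_def matrix_vector_mult_def sum_distrib_left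
        algebra_simps)
  finally show "expectation (\<lambda>\<omega>. (X \<omega> \<bullet> a)\<^sup>2) = a \<bullet> (covariance_matrix M X *v a)" .
qed

lemma (in prob_space) sym_psd_covariance_matrix:
  fixes X :: "'a \<Rightarrow> real^'n::finite"
  assumes "X \<in> borel_measurable M" "\<And>i. integrable M (\<lambda>\<omega>. (X \<omega> $ i)\<^sup>2)" "mean_vector M X = 0"
  shows "sym_psd (covariance_matrix M X)"
proof -
  have "transpose (covariance_matrix M X) = covariance_matrix M X"
    by (simp add: covariance_matrix_def transpose_def vec_eq_iff mult.commute)
  moreover have "0 \<le> a \<bullet> (covariance_matrix M X *v a)" for a
    by (simp add: linear_form_variance[OF assms, symmetric])
  ultimately show ?thesis by (simp add: sym_psd_def)
qed

section \<open>The probability bound\<close>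

theorem proposition6:
  fixes M :: "'a measure"
    and \<delta>' :: "'a \<Rightarrow> real^'n::finite"
    and \<Sigma> :: "real^'n^'n::finite"
    and E :: "'n::finite set set"
    and \<gamma> :: "'n::finite \<Rightarrow> 'n \<Rightarrow> real"
    and Z :: "((real^'nx::finite) \<times> (real^'ny::finite)) set"
    and C :: "real^'nx::finite^'n::finite"
    and d :: "real^'ny::finite"
    and c p :: real
  assumes "prob_space M"
    and "\<delta>' \<in> borel_measurable M"
    and "\<forall>i. integrable M (\<lambda>\<omega>. (\<delta>' \<omega> $ i)\<^sup>2)"
    and "mean_vector M \<delta>' = 0"
    and "covariance_matrix M \<delta>' = \<Sigma>"
    and "\<forall>i. \<Sigma> $ i $ i = 1"
    and "\<forall>e\<in>E. card e = 2"
    and "\<forall>(x, y)\<in>Z. (\<forall>k. x $ k \<ge> 0) \<and> (\<forall>k. y $ k \<ge> 0)"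
    and "0 < p" and "p < 1"
    and "\<forall>i j. {i, j} \<in> E \<longrightarrow> \<gamma> i j = \<gamma> j i"
    and "\<forall>i j. {i, j} \<in> E \<or> i = j \<longrightarrow>
           \<gamma> i j \<ge> sqrt (1 / p - 1) * norm (psd_sqrt \<Sigma> *v edge_vec i j)"
  shows "\<forall>(x, y)\<in>Z.
           max_on (uncertainty_set E \<gamma>) (\<lambda>\<delta>. \<delta> \<bullet> (C *v x) + d \<bullet> y) \<le> c \<longrightarrow>
           \<P>(\<omega> in M. \<delta>' \<omega> \<bullet> (C *v x) + d \<bullet> y > c) \<le> p"
proof (safe, rename_tac x y)
  fix x :: "real^'nx" and y :: "real^'ny"
  let ?f = "\<lambda>\<delta>. \<delta> \<bullet> (C *v x) + d \<bullet> y"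
  assume robust: "max_on (uncertainty_set E \<gamma>) ?f \<le> c"
  interpret prob_space M by fact
  note moments = assms(2) assms(3)[rule_format] assms(4)
  define a where "a = C *v x"
  let ?r = "sqrt (1 / p - 1)"
  have \<Sigma>: "sym_psd \<Sigma>"
    using sym_psd_covariance_matrix[OF moments] assms(5) by simp
  have "?r \<ge> 0"
    using assms(9,10) by simp
  then obtain u where u: "u \<bullet> a = ?r * norm (psd_sqrt \<Sigma> *v a)"
    and u_le: "\<And>e. \<bar>u \<bullet> e\<bar> \<le> ?r * norm (psd_sqrt \<Sigma> *v e)"
    using ellipsoid_extremal_point[OF \<Sigma>] by blast
  have bound: "\<bar>u \<bullet> edge_vec i j\<bar> \<le> \<gamma> i j" if "{i, j} \<in> E \<or> i = j" for i j
    using u_le[of "edge_vec i j"] assms(12) that by force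
  have "u \<in> uncertainty_set E \<gamma>"
    unfolding uncertainty_set_def
  proof (intro CollectI conjI allI impI)
    show "\<bar>u $ i\<bar> \<le> \<gamma> i i" for i
      using bound[of i i] by (simp add: edge_vec_def inner_axis)
    fix i j assume ij: "{i, j} \<in> E"
    then have "i \<noteq> j"
      using assms(7) by fastforce
    then show "\<bar>u $ i - u $ j\<bar> \<le> \<gamma> i j"
      using bound[of i j] ij by (simp add: edge_vec_def inner_diff inner_axis)
  qed
  \<comment> \<open>So robust feasibility controls the value at \<open>u\<close>, that is, \<open>?r\<close> standard deviations.\<close>
  then have "?f u \<le> max_on (uncertainty_set E \<gamma>) ?f"
    by (intro max_on_upper compact_uncertainty_set continuous_intros)
  then have "u \<bullet> a \<le> c - d \<bullet> y"
    using robust by (simp add: a_def)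
  moreover have "expectation (\<lambda>\<omega>. (\<delta>' \<omega> \<bullet> a)\<^sup>2) = (norm (psd_sqrt \<Sigma> *v a))\<^sup>2"
    using linear_form_variance[OF moments] norm_psd_sqrt_mult[OF \<Sigma>] assms(5) by simp
  ultimately have "?r * sqrt (expectation (\<lambda>\<omega>. (\<delta>' \<omega> \<bullet> a)\<^sup>2)) \<le> c - d \<bullet> y"
    by (simp add: u)
  then have "prob {\<omega> \<in> space M. \<delta>' \<omega> \<bullet> a > c - d \<bullet> y} \<le> p"
    using assms(2,9,10) linear_form_mean[OF moments] linear_form_square_integrable[OF moments]
    by (intro prob_exceeds_sqrt_variance) simp_all
  then show "\<P>(\<omega> in M. ?f (\<delta>' \<omega>) > c) \<le> p"
    by (simp add: a_def diff_less_eq)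
qed
end
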